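(* Let $K\ge d>0$, $T\ge 2$. Let $(x,s)$ and $(\tilde x,\tilde s)$ be distributed according to two ARPLN-ICA models with a single regime ($C=1$), i.e. $s_1\sim\mathcal{N}(m,\Phi)$ and, conditionally on $s_1,\dots,s_t$, $s_{t+1}\sim\mathcal{N}(Bs_t+b,\Psi)$, with $B\in\mathbb{R}^{d\times d}$ diagonal, $b,m\in\mathbb{R}^d$, and $\Phi,\Psi$ diagonal with positive diagonal entries; and, conditionally on $s$, the entries $x_t^{(k)}$ are independent with $x_t^{(k)}\sim\mathcal{P}(\exp((\Gamma s_t)^{(k)}))$ (similarly for the tilde model with parameters $\tilde m,\tilde\Phi,\tilde B,\tilde b,\tilde\Psi,\tilde\Gamma$). Assume $\Gamma,\tilde\Gamma\in\mathbb{R}^{K\times d}$ have rank $d$ and that $B$ and $\tilde B$ have non-zero, pairwise distinct diagonal entries. If $x$ and $\tilde x$ have the same distribution, then there exist a permutation matrix $P$ and an invertible diagonal matrix $D$ such that $\tilde\Gamma=\Gamma P D^{-1}$.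
   Context: $\mathcal{P}$ denotes the Poisson distribution; $\mathcal{N}(\mu,\Sigma)$ the Gaussian distribution. Diagonal covariances mean the $d$ coordinates of the latent process evolve independently. *)

theory Defs
  imports "HOL-Analysis.Analysis" "HOL-Probability.Probability"
begin

definition is_diag :: "real^'d^'d \<Rightarrow> bool" where
  "is_diag A \<longleftrightarrow> (\<forall>i j. i \<noteq> j \<longrightarrow> A $ i $ j = 0)"

definition is_perm_matrix :: "real^'d^'d \<Rightarrow> bool" where
  "is_perm_matrix P \<longleftrightarrow> (\<exists>p. p permutes (UNIV :: 'd set) \<and>
      P = (\<chi> i j. if i = p j then 1 else 0))"

text \<open>Joint Lebesgue density of the latent Gaussian AR(1) process s_0,...,s_(T-1)
  in (R^d)^T, for diagonal B, Phi, Psi (only diagonal entries enter):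
  s_0 ~ N(m, Phi), s_(t+1) | s_t ~ N(B s_t + b, Psi).\<close>
definition latent_density ::
  "nat \<Rightarrow> real^'d \<Rightarrow> real^'d^'d \<Rightarrow> real^'d^'d \<Rightarrow> real^'d \<Rightarrow> real^'d^'d
     \<Rightarrow> (nat \<Rightarrow> real^'d) \<Rightarrow> real" where
  "latent_density T m \<Phi> B b \<Psi> s =
     (\<Prod>i\<in>UNIV. normal_density (m $ i) (sqrt (\<Phi> $ i $ i)) (s 0 $ i) *
        (\<Prod>t<T - 1. normal_density (B $ i $ i * (s t $ i) + b $ i) (sqrt (\<Psi> $ i $ i))
                         (s (Suc t) $ i)))"

text \<open>Probability that the observed count process equals y (time indices 0..T-1),
  x_t^(k) | s ~ Poisson(exp((Gamma s_t)^(k))) independently.\<close>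
definition obs_prob ::
  "nat \<Rightarrow> real^'d \<Rightarrow> real^'d^'d \<Rightarrow> real^'d^'d \<Rightarrow> real^'d \<Rightarrow> real^'d^'d \<Rightarrow> real^'d^'k
     \<Rightarrow> (nat \<Rightarrow> nat^'k) \<Rightarrow> ennreal" where
  "obs_prob T m \<Phi> B b \<Psi> \<Gamma> y =
     (\<integral>\<^sup>+ s. ennreal (latent_density T m \<Phi> B b \<Psi> s *
         (\<Prod>t<T. \<Prod>k\<in>UNIV. pmf (poisson_pmf (exp ((\<Gamma> *v s t) $ k))) (y t $ k)))
      \<partial>(PiM {..<T} (\<lambda>_. (lborel :: (real^'d) measure))))"

definition ARPLN_params :: "real^'d \<Rightarrow> real^'d^'d \<Rightarrow> real^'d^'d \<Rightarrow> real^'d \<Rightarrow> real^'d^'d \<Rightarrow> bool" where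
  "ARPLN_params m \<Phi> B b \<Psi> \<longleftrightarrow> is_diag \<Phi> \<and> is_diag \<Psi> \<and> is_diag B \<and>
     (\<forall>i. \<Phi> $ i $ i > 0) \<and> (\<forall>i. \<Psi> $ i $ i > 0)"

end

(* For conditionally Poisson counts, factorial moments are moments of the intensities: weighting
   each count x_t^(k) by its falling factorial of order j(t,k) and integrating gives
   E exp (sum of j(t,k) (Gamma s_t)_k).  For the Gaussian latent process and j supported on the
   first two time points this is the exponential of an explicit quadratic form in
   (Gamma^T j_0, Gamma^T j_1), so equal observation laws give equal quadratic forms.  Polarizing
   them yields Gamma Phi Gamma^T = Gamma' Phi' Gamma'^T and Gamma B Phi Gamma^T = Gamma' B' Phi' Gamma'^T,
   the covariances of Gamma s_0 with Gamma s_0 and with Gamma s_1.  As Gamma has full column rank,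
   the first identity gives Gamma' = Gamma R; substituting into both identities and cancelling
   Gamma gives B R = R B', and since the diagonal entries of B and B' are pairwise distinct,
   R is a permutation matrix times an invertible diagonal matrix. *)

theory Submission
  imports Defs
begin

section \<open>Gaussian and Poisson integrals\<close>

lemma normal_density_mult_exp:
  assumes "0 < \<sigma>"
  shows "normal_density \<mu> \<sigma> x * exp (c * x) =
    exp (c * \<mu> + c\<^sup>2 * \<sigma>\<^sup>2 / 2) * normal_density (\<mu> + c * \<sigma>\<^sup>2) \<sigma> x"
proof -
  have "- (x - \<mu>)\<^sup>2 / (2 * \<sigma>\<^sup>2) + c * x =
      c * \<mu> + c\<^sup>2 * \<sigma>\<^sup>2 / 2 + - (x - (\<mu> + c * \<sigma>\<^sup>2))\<^sup>2 / (2 * \<sigma>\<^sup>2)"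
    using assms by (simp add: field_simps power2_eq_square)
  then show ?thesis
    unfolding normal_density_def by (simp add: exp_add[symmetric] algebra_simps)
qed

lemma nn_integral_normal_density_mult_exp:
  assumes "0 < \<sigma>"
  shows "(\<integral>\<^sup>+x. ennreal (normal_density \<mu> \<sigma> x * exp (c * x)) \<partial>lborel) =
    ennreal (exp (c * \<mu> + c\<^sup>2 * \<sigma>\<^sup>2 / 2))"
  using assms
  by (simp add: normal_density_mult_exp ennreal_mult' nn_integral_cmult nn_integral_eq_integral)

lemma nn_integral_lborel_vec_prod:
  fixes f :: "'d::finite \<Rightarrow> real \<Rightarrow> real"
  assumes [measurable]: "\<And>i. f i \<in> borel_measurable borel"
    and nonneg: "\<And>i x. 0 \<le> f i x"
  shows "(\<integral>\<^sup>+(x::real^'d). ennreal (\<Prod>i\<in>UNIV. f i (x $ i)) \<partial>lborel) =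
    (\<Prod>i\<in>UNIV. \<integral>\<^sup>+y. ennreal (f i y) \<partial>lborel)"
proof -
  let ?e = "\<lambda>i::'d. axis i (1::real)"
  define g where "g b = f (inv ?e b)" for b
  have inj: "inj ?e" by (auto simp: inj_def axis_eq_axis)
  have Basis: "(Basis :: (real^'d) set) = range ?e" by (auto simp: Basis_vec_def)
  have g: "g (?e i) = f i" for i by (simp add: g_def inv_f_f[OF inj])
  have "(\<integral>\<^sup>+x. ennreal (\<Prod>i\<in>UNIV. f i (x $ i)) \<partial>lborel) =
      (\<integral>\<^sup>+(x::real^'d). (\<Prod>b\<in>Basis. ennreal (g b (x \<bullet> b))) \<partial>lborel)"
    by (simp add: Basis prod.reindex[OF inj] g inner_axis prod_ennreal nonneg)
  also have "\<dots> = (\<Prod>b\<in>Basis. \<integral>\<^sup>+y. ennreal (g b y) \<partial>lborel)"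
    by (rule nn_integral_lborel_prod) (auto simp: Basis g)
  also have "\<dots> = (\<Prod>i\<in>UNIV. \<integral>\<^sup>+y. ennreal (f i y) \<partial>lborel)"
    by (simp add: Basis prod.reindex[OF inj] g)
  finally show ?thesis .
qed

definition indep_normal_density :: "('d::finite \<Rightarrow> real) \<Rightarrow> ('d \<Rightarrow> real) \<Rightarrow> real^'d \<Rightarrow> real" where
  "indep_normal_density \<mu> \<sigma> x = (\<Prod>i\<in>UNIV. normal_density (\<mu> i) (\<sigma> i) (x $ i))"

lemma indep_normal_density_nonneg: "0 \<le> indep_normal_density \<mu> \<sigma> x"
  by (simp add: indep_normal_density_def prod_nonneg)

lemma borel_measurable_indep_normal_density [measurable]:
  "(\<lambda>x. indep_normal_density \<mu> \<sigma> x) \<in> borel_measurable borel"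
  unfolding indep_normal_density_def by measurable

lemma nn_integral_indep_normal_density_mult_exp:
  assumes "\<And>i. 0 < \<sigma> i"
  shows "(\<integral>\<^sup>+x. ennreal (indep_normal_density \<mu> \<sigma> x * exp (c \<bullet> x)) \<partial>lborel) =
    ennreal (exp (\<Sum>i\<in>UNIV. c $ i * \<mu> i + (c $ i)\<^sup>2 * (\<sigma> i)\<^sup>2 / 2))"
proof -
  have "indep_normal_density \<mu> \<sigma> x * exp (c \<bullet> x) =
      (\<Prod>i\<in>UNIV. normal_density (\<mu> i) (\<sigma> i) (x $ i) * exp (c $ i * x $ i))" for x
    by (simp add: indep_normal_density_def inner_vec_def exp_sum prod.distrib)
  then have "(\<integral>\<^sup>+x. ennreal (indep_normal_density \<mu> \<sigma> x * exp (c \<bullet> x)) \<partial>lborel) =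
      (\<Prod>i\<in>UNIV. \<integral>\<^sup>+y. ennreal (normal_density (\<mu> i) (\<sigma> i) y * exp (c $ i * y)) \<partial>lborel)"
    by (simp only:) (rule nn_integral_lborel_vec_prod; simp)
  then show ?thesis
    using assms by (simp add: nn_integral_normal_density_mult_exp prod_ennreal exp_sum)
qed

lemma nn_integral_indep_normal_density:
  assumes "\<And>i. 0 < \<sigma> i"
  shows "(\<integral>\<^sup>+x. ennreal (indep_normal_density \<mu> \<sigma> x) \<partial>lborel) = 1"
  using nn_integral_indep_normal_density_mult_exp[OF assms, where c=0] by simp

text \<open>\<open>fact j * (n choose j)\<close> is the falling factorial \<open>n (n - 1) \<cdots> (n - j + 1)\<close>.\<close>

lemma poisson_falling_factorial_moment:
  assumes "0 < r"
  shows "(\<integral>\<^sup>+n. ennreal (pmf (poisson_pmf r) n * (fact j * real (n choose j))) \<partial>count_space UNIV) =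
    ennreal (r ^ j)"
proof -
  define f where "f n = pmf (poisson_pmf r) n * (fact j * real (n choose j))" for n
  have shifted: "f (n + j) = (r ^ j * exp (- r)) * (r ^ n /\<^sub>R fact n)" for n
  proof -
    have "fact j * real (n + j choose j) = fact (n + j) / fact n"
      using fact_binomial[of j "n + j"] by simp
    then show ?thesis
      using assms by (simp add: f_def power_add field_simps)
  qed
  have "(\<lambda>n. f (n + j)) sums ((r ^ j * exp (- r)) * exp r)"
    unfolding shifted by (rule sums_mult[OF exp_converges])
  moreover have "(\<Sum>n<j. f n) = 0"
    by (simp add: f_def binomial_eq_0)
  ultimately have "f sums (r ^ j)"
    by (simp add: sums_iff_shift exp_minus field_simps)
  moreover have "0 \<le> f n" for n
    using assms by (simp add: f_def)
  ultimately show ?thesis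
    unfolding f_def[symmetric]
    by (simp add: nn_integral_count_space_nat suminf_ennreal2 sums_iff)
qed

lemma nn_integral_PiM_poisson_falling_factorial:
  assumes "finite I" and "\<And>a. a \<in> I \<Longrightarrow> 0 < r a"
  shows "(\<integral>\<^sup>+Y. (\<Prod>a\<in>I. ennreal (pmf (poisson_pmf (r a)) (Y a) * (fact (j a) * real (Y a choose j a))))
      \<partial>PiM I (\<lambda>_. count_space UNIV)) = ennreal (\<Prod>a\<in>I. r a ^ j a)"
proof -
  interpret product_sigma_finite "\<lambda>_. count_space (UNIV :: nat set)"
    by (intro product_sigma_finite.intro sigma_finite_measure_count_space_countable) auto
  have "(\<integral>\<^sup>+Y. (\<Prod>a\<in>I. ennreal (pmf (poisson_pmf (r a)) (Y a) * (fact (j a) * real (Y a choose j a))))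
      \<partial>PiM I (\<lambda>_. count_space UNIV)) =
    (\<Prod>a\<in>I. \<integral>\<^sup>+n. ennreal (pmf (poisson_pmf (r a)) n * (fact (j a) * real (n choose j a))) \<partial>count_space UNIV)"
    using assms(1) by (rule product_nn_integral_prod) simp
  also have "\<dots> = (\<Prod>a\<in>I. ennreal (r a ^ j a))"
    using assms(2) by (intro prod.cong refl poisson_falling_factorial_moment)
  also have "\<dots> = ennreal (\<Prod>a\<in>I. r a ^ j a)"
    using assms(2) by (simp add: prod_ennreal less_imp_le)
  finally show ?thesis .
qed

section \<open>The latent Gaussian process\<close>

lemma latent_density_nonneg: "0 \<le> latent_density T m \<Phi> B b \<Psi> s"
  by (simp add: latent_density_def prod_nonneg)

lemma latent_density_cong:
  assumes "\<And>t. t < n \<Longrightarrow> s t = s' t" and "0 < n"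
  shows "latent_density n m \<Phi> B b \<Psi> s = latent_density n m \<Phi> B b \<Psi> s'"
  using assms unfolding latent_density_def by (intro prod.cong arg_cong2[where f="(*)"]) auto

lemma latent_density_Suc:
  assumes "0 < n"
  shows "latent_density (Suc n) m \<Phi> B b \<Psi> s = latent_density n m \<Phi> B b \<Psi> s *
    indep_normal_density (\<lambda>i. B $ i $ i * s (n - 1) $ i + b $ i) (\<lambda>i. sqrt (\<Psi> $ i $ i)) (s n)"
proof -
  obtain k where "n = Suc k"
    using assms by (cases n) auto
  then show ?thesis
    by (simp add: latent_density_def indep_normal_density_def prod.distrib[symmetric] mult_ac)
qed

lemma latent_density_two:
  "latent_density 2 m \<Phi> B b \<Psi> s =
    indep_normal_density (\<lambda>i. m $ i) (\<lambda>i. sqrt (\<Phi> $ i $ i)) (s 0) *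
    indep_normal_density (\<lambda>i. B $ i $ i * s 0 $ i + b $ i) (\<lambda>i. sqrt (\<Psi> $ i $ i)) (s 1)"
  by (simp add: latent_density_def indep_normal_density_def prod.distrib numeral_2_eq_2)

lemma measurable_PiM_vec_component:
  assumes "t \<in> I"
  shows "(\<lambda>s. s t $ i) \<in> borel_measurable (PiM I (\<lambda>_. lborel :: (real^'d) measure))"
proof -
  have "(\<lambda>x::real^'d. x $ i) \<in> borel_measurable lborel"
    by simp
  from measurable_comp[OF measurable_component_singleton[OF assms] this]
  show ?thesis
    by (simp add: comp_def)
qed

lemma borel_measurable_latent_density [measurable]:
  assumes "0 < n" and "T \<le> n"
  shows "latent_density T m \<Phi> B b \<Psi> \<in> borel_measurable (PiM {..<n} (\<lambda>_. lborel :: (real^'d) measure))"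
  unfolding latent_density_def
proof (intro borel_measurable_prod borel_measurable_times)
  fix i :: 'd
  have [measurable]: "(\<lambda>s. s 0 $ i) \<in> borel_measurable (PiM {..<n} (\<lambda>_. lborel :: (real^'d) measure))"
    using assms by (intro measurable_PiM_vec_component) auto
  show "(\<lambda>s. normal_density (m $ i) (sqrt (\<Phi> $ i $ i)) (s 0 $ i))
      \<in> borel_measurable (PiM {..<n} (\<lambda>_. lborel))"
    by measurable
  fix t assume "t \<in> {..<T - 1}"
  then have [measurable]: "(\<lambda>s. s t $ i) \<in> borel_measurable (PiM {..<n} (\<lambda>_. lborel :: (real^'d) measure))"
      "(\<lambda>s. s (Suc t) $ i) \<in> borel_measurable (PiM {..<n} (\<lambda>_. lborel :: (real^'d) measure))"
    using assms by (auto intro!: measurable_PiM_vec_component)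
  show "(\<lambda>s. normal_density (B $ i $ i * s t $ i + b $ i) (sqrt (\<Psi> $ i $ i)) (s (Suc t) $ i))
      \<in> borel_measurable (PiM {..<n} (\<lambda>_. lborel))"
    unfolding normal_density_def by measurable
qed

lemma borel_measurable_exp_inner_01 [measurable]:
  assumes "Suc 0 < n"
  shows "(\<lambda>s. exp (c0 \<bullet> s 0 + c1 \<bullet> s 1)) \<in> borel_measurable (PiM {..<n} (\<lambda>_. lborel :: (real^'d) measure))"
proof -
  have [measurable]: "(\<lambda>s. s t $ i) \<in> borel_measurable (PiM {..<n} (\<lambda>_. lborel :: (real^'d) measure))"
    if "t \<le> 1" for t and i :: 'd
    using assms that by (intro measurable_PiM_vec_component) auto
  show ?thesis
    unfolding inner_vec_def by measurable
qed

lemma borel_measurable_latent_density_mult_exp: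
  assumes "2 \<le> n" and "T \<le> n"
  shows "(\<lambda>s. ennreal (latent_density T m \<Phi> B b \<Psi> s * exp (c0 \<bullet> s 0 + c1 \<bullet> s 1)))
    \<in> borel_measurable (PiM {..<n} (\<lambda>_. lborel :: (real^'d) measure))"
  using assms
  by (intro measurable_compose[OF _ measurable_ennreal] borel_measurable_times
      borel_measurable_latent_density borel_measurable_exp_inner_01) auto

definition latent_log_mgf ::
  "real^'d \<Rightarrow> real^'d^'d \<Rightarrow> real^'d^'d \<Rightarrow> real^'d \<Rightarrow> real^'d^'d \<Rightarrow> real^'d \<Rightarrow> real^'d \<Rightarrow> real" where
  "latent_log_mgf m \<Phi> B b \<Psi> c0 c1 = (\<Sum>i\<in>UNIV. (c0 $ i + c1 $ i * B $ i $ i) * m $ i + c1 $ i * b $ i +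
      ((c0 $ i + c1 $ i * B $ i $ i)\<^sup>2 * \<Phi> $ i $ i + (c1 $ i)\<^sup>2 * \<Psi> $ i $ i) / 2)"

lemma nn_integral_transition_mult_exp:
  assumes "\<And>i. 0 < \<Psi> $ i $ i"
  shows "(\<integral>\<^sup>+y. ennreal (indep_normal_density (\<lambda>i. B $ i $ i * x $ i + b $ i) (\<lambda>i. sqrt (\<Psi> $ i $ i)) y *
      exp (c \<bullet> y)) \<partial>lborel) =
    ennreal (exp ((\<chi> i. c $ i * B $ i $ i) \<bullet> x + (\<Sum>i\<in>UNIV. c $ i * b $ i + (c $ i)\<^sup>2 * \<Psi> $ i $ i / 2)))"
proof -
  have "(\<Sum>i\<in>UNIV. c $ i * (B $ i $ i * x $ i + b $ i) + (c $ i)\<^sup>2 * (sqrt (\<Psi> $ i $ i))\<^sup>2 / 2) =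
      (\<chi> i. c $ i * B $ i $ i) \<bullet> x + (\<Sum>i\<in>UNIV. c $ i * b $ i + (c $ i)\<^sup>2 * \<Psi> $ i $ i / 2)"
    using assms by (simp add: inner_vec_def sum.distrib[symmetric] less_imp_le algebra_simps)
  then show ?thesis
    using assms by (simp add: nn_integral_indep_normal_density_mult_exp)
qed

lemma nn_integral_latent_density_Suc_exp:
  assumes "2 \<le> n" and \<Psi>: "\<And>i. 0 < \<Psi> $ i $ i"
  shows "(\<integral>\<^sup>+s. ennreal (latent_density (Suc n) m \<Phi> B b \<Psi> s * exp (c0 \<bullet> s 0 + c1 \<bullet> s 1))
      \<partial>PiM {..<Suc n} (\<lambda>_. lborel :: (real^'d) measure)) =
    (\<integral>\<^sup>+s. ennreal (latent_density n m \<Phi> B b \<Psi> s * exp (c0 \<bullet> s 0 + c1 \<bullet> s 1))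
      \<partial>PiM {..<n} (\<lambda>_. lborel))"
    (is "_ = (\<integral>\<^sup>+s. ennreal (?f s) \<partial>_)")
proof -
  interpret product_sigma_finite "\<lambda>_. lborel :: (real^'d) measure"
    by standard
  let ?g = "\<lambda>x. indep_normal_density (\<lambda>i. B $ i $ i * x (n - 1) $ i + b $ i) (\<lambda>i. sqrt (\<Psi> $ i $ i))"
  have "(\<integral>\<^sup>+s. ennreal (latent_density (Suc n) m \<Phi> B b \<Psi> s * exp (c0 \<bullet> s 0 + c1 \<bullet> s 1))
      \<partial>PiM {..<Suc n} (\<lambda>_. lborel)) =
    (\<integral>\<^sup>+x. \<integral>\<^sup>+y. ennreal (latent_density (Suc n) m \<Phi> B b \<Psi> (x(n := y)) *
        exp (c0 \<bullet> (x(n := y)) 0 + c1 \<bullet> (x(n := y)) 1)) \<partial>lborel \<partial>PiM {..<n} (\<lambda>_. lborel))"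
    using borel_measurable_latent_density_mult_exp[of "Suc n" "Suc n"] assms(1)
    unfolding lessThan_Suc by (intro product_nn_integral_insert) auto
  also have "\<dots> = (\<integral>\<^sup>+x. \<integral>\<^sup>+y. ennreal (?f x) * ennreal (?g x y) \<partial>lborel
      \<partial>PiM {..<n} (\<lambda>_. lborel))"
  proof (intro nn_integral_cong)
    fix x :: "nat \<Rightarrow> real^'d" and y :: "real^'d"
    have "latent_density n m \<Phi> B b \<Psi> (x(n := y)) = latent_density n m \<Phi> B b \<Psi> x"
      using assms(1) by (intro latent_density_cong) auto
    moreover have "n - 1 \<noteq> n"
      using assms(1) by simp
    ultimately show "ennreal (latent_density (Suc n) m \<Phi> B b \<Psi> (x(n := y)) *
        exp (c0 \<bullet> (x(n := y)) 0 + c1 \<bullet> (x(n := y)) 1)) = ennreal (?f x) * ennreal (?g x y)"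
      using assms(1)
      by (simp add: latent_density_Suc latent_density_nonneg indep_normal_density_nonneg
          ennreal_mult'[symmetric] mult_ac)
  qed
  also have "\<dots> = (\<integral>\<^sup>+x. ennreal (?f x) \<partial>PiM {..<n} (\<lambda>_. lborel))"
    using \<Psi> by (simp add: nn_integral_cmult nn_integral_indep_normal_density)
  finally show ?thesis .
qed

lemma nn_integral_latent_density_two_second_exp:
  assumes \<Psi>: "\<And>i. 0 < \<Psi> $ i $ i"
  shows "(\<integral>\<^sup>+y. ennreal (latent_density 2 m \<Phi> B b \<Psi> (x(1 := y)) * exp (c0 \<bullet> x 0 + c1 \<bullet> y)) \<partial>lborel) =
    ennreal (exp (\<Sum>i\<in>UNIV. c1 $ i * b $ i + (c1 $ i)\<^sup>2 * \<Psi> $ i $ i / 2)) *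
    ennreal (indep_normal_density (\<lambda>i. m $ i) (\<lambda>i. sqrt (\<Phi> $ i $ i)) (x 0) *
      exp ((c0 + (\<chi> i. c1 $ i * B $ i $ i)) \<bullet> x 0))"
proof -
  let ?p0 = "indep_normal_density (\<lambda>i. m $ i) (\<lambda>i. sqrt (\<Phi> $ i $ i)) (x 0)"
  let ?p1 = "indep_normal_density (\<lambda>i. B $ i $ i * x 0 $ i + b $ i) (\<lambda>i. sqrt (\<Psi> $ i $ i))"
  have "latent_density 2 m \<Phi> B b \<Psi> (x(1 := y)) * exp (c0 \<bullet> x 0 + c1 \<bullet> y) =
      (?p0 * exp (c0 \<bullet> x 0)) * (?p1 y * exp (c1 \<bullet> y))" for y
    by (simp add: latent_density_two exp_add)
  then have "(\<integral>\<^sup>+y. ennreal (latent_density 2 m \<Phi> B b \<Psi> (x(1 := y)) * exp (c0 \<bullet> x 0 + c1 \<bullet> y)) \<partial>lborel) =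
      (\<integral>\<^sup>+y. ennreal (?p0 * exp (c0 \<bullet> x 0)) * ennreal (?p1 y * exp (c1 \<bullet> y)) \<partial>lborel)"
    by (simp add: indep_normal_density_nonneg ennreal_mult')
  also have "\<dots> = ennreal (?p0 * exp (c0 \<bullet> x 0)) * (\<integral>\<^sup>+y. ennreal (?p1 y * exp (c1 \<bullet> y)) \<partial>lborel)"
    by (rule nn_integral_cmult) measurable
  also have "\<dots> = ennreal (?p0 * exp (c0 \<bullet> x 0)) * ennreal (exp ((\<chi> i. c1 $ i * B $ i $ i) \<bullet> x 0 +
      (\<Sum>i\<in>UNIV. c1 $ i * b $ i + (c1 $ i)\<^sup>2 * \<Psi> $ i $ i / 2)))"
    by (simp only: nn_integral_transition_mult_exp[OF \<Psi>])
  finally show ?thesis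
    by (simp add: indep_normal_density_nonneg inner_left_distrib ennreal_mult'[symmetric] mult_ac
        flip: exp_add)
qed

lemma nn_integral_latent_density_two_exp:
  assumes \<Phi>: "\<And>i. 0 < \<Phi> $ i $ i" and \<Psi>: "\<And>i. 0 < \<Psi> $ i $ i"
  shows "(\<integral>\<^sup>+s. ennreal (latent_density 2 m \<Phi> B b \<Psi> s * exp (c0 \<bullet> s 0 + c1 \<bullet> s 1))
      \<partial>PiM {..<2} (\<lambda>_. lborel :: (real^'d) measure)) = ennreal (exp (latent_log_mgf m \<Phi> B b \<Psi> c0 c1))"
proof -
  interpret product_sigma_finite "\<lambda>_. lborel :: (real^'d) measure"
    by standard
  define \<kappa> where "\<kappa> = (\<Sum>i\<in>UNIV. c1 $ i * b $ i + (c1 $ i)\<^sup>2 * \<Psi> $ i $ i / 2)"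
  define a :: "real^'d" where "a = c0 + (\<chi> i. c1 $ i * B $ i $ i)"
  let ?p0 = "indep_normal_density (\<lambda>i. m $ i) (\<lambda>i. sqrt (\<Phi> $ i $ i))"
  have two: "{..<2::nat} = insert 1 {0}"
    by auto
  have "(\<integral>\<^sup>+s. ennreal (latent_density 2 m \<Phi> B b \<Psi> s * exp (c0 \<bullet> s 0 + c1 \<bullet> s 1))
      \<partial>PiM {..<2} (\<lambda>_. lborel)) =
    (\<integral>\<^sup>+x. \<integral>\<^sup>+y. ennreal (latent_density 2 m \<Phi> B b \<Psi> (x(1 := y)) *
        exp (c0 \<bullet> (x(1 := y)) 0 + c1 \<bullet> (x(1 := y)) 1)) \<partial>lborel \<partial>PiM {0::nat} (\<lambda>_. lborel))"
    using borel_measurable_latent_density_mult_exp[of 2 2] unfolding two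
    by (intro product_nn_integral_insert) auto
  also have "\<dots> = (\<integral>\<^sup>+x. ennreal (exp \<kappa>) * ennreal (?p0 (x 0) * exp (a \<bullet> x 0)) \<partial>PiM {0::nat} (\<lambda>_. lborel))"
    using nn_integral_latent_density_two_second_exp[OF \<Psi>] by (simp add: \<kappa>_def a_def)
  also have "\<dots> = ennreal (exp \<kappa>) * (\<integral>\<^sup>+v. ennreal (?p0 v * exp (a \<bullet> v)) \<partial>lborel)"
    by (subst product_nn_integral_singleton) (simp_all add: nn_integral_cmult)
  also have "\<dots> = ennreal (exp \<kappa>) *
      ennreal (exp (\<Sum>i\<in>UNIV. a $ i * m $ i + (a $ i)\<^sup>2 * (sqrt (\<Phi> $ i $ i))\<^sup>2 / 2))"
    using \<Phi> by (subst nn_integral_indep_normal_density_mult_exp) simp_all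
  also have "\<dots> = ennreal (exp (latent_log_mgf m \<Phi> B b \<Psi> c0 c1))"
    using \<Phi>
    by (simp add: ennreal_mult'[symmetric] less_imp_le latent_log_mgf_def \<kappa>_def a_def
        sum.distrib[symmetric] add_divide_distrib algebra_simps flip: exp_add)
  finally show ?thesis .
qed

lemma nn_integral_latent_density_exp:
  assumes "2 \<le> T" and "\<And>i. 0 < \<Phi> $ i $ i" and "\<And>i. 0 < \<Psi> $ i $ i"
  shows "(\<integral>\<^sup>+s. ennreal (latent_density T m \<Phi> B b \<Psi> s * exp (c0 \<bullet> s 0 + c1 \<bullet> s 1))
      \<partial>PiM {..<T} (\<lambda>_. lborel :: (real^'d) measure)) = ennreal (exp (latent_log_mgf m \<Phi> B b \<Psi> c0 c1))"
  using assms(1)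
proof (induction T rule: nat_induct_at_least)
  case base
  then show ?case
    using nn_integral_latent_density_two_exp[OF assms(2,3)] by simp
next
  case (Suc n)
  then show ?case
    using nn_integral_latent_density_Suc_exp[OF Suc(1) assms(3)] by simp
qed

section \<open>Factorial moments of the counts\<close>

text \<open>The counts are encoded as one function on the pairs \<open>(t, k) \<in> obs_index T\<close>, so that their law
  lives on a product of counting spaces.\<close>

definition obs_index :: "nat \<Rightarrow> (nat \<times> 'k::finite) set" where
  "obs_index T = {..<T} \<times> UNIV"

definition obs_space :: "nat \<Rightarrow> (nat \<times> 'k::finite \<Rightarrow> nat) measure" where
  "obs_space T = PiM (obs_index T) (\<lambda>_. count_space UNIV)"

definition obs_seq :: "(nat \<times> 'k::finite \<Rightarrow> nat) \<Rightarrow> nat \<Rightarrow> nat^'k" where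
  "obs_seq Y t = (\<chi> k. Y (t, k))"

definition count_likelihood :: "nat \<Rightarrow> real^'d^'k \<Rightarrow> (nat \<Rightarrow> real^'d) \<Rightarrow> (nat \<times> 'k::finite \<Rightarrow> nat) \<Rightarrow> real" where
  "count_likelihood T \<Gamma> s Y = (\<Prod>a\<in>obs_index T. pmf (poisson_pmf (exp ((\<Gamma> *v s (fst a)) $ snd a))) (Y a))"

definition falling_factorial_weight :: "nat \<Rightarrow> (nat \<times> 'k::finite \<Rightarrow> nat) \<Rightarrow> (nat \<times> 'k \<Rightarrow> nat) \<Rightarrow> real" where
  "falling_factorial_weight T j Y = (\<Prod>a\<in>obs_index T. fact (j a) * real (Y a choose j a))"

definition count_exponent :: "(nat \<times> 'k::finite \<Rightarrow> nat) \<Rightarrow> nat \<Rightarrow> real^'k" where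
  "count_exponent j t = (\<chi> k. real (j (t, k)))"

definition factorial_moment ::
  "nat \<Rightarrow> real^'d \<Rightarrow> real^'d^'d \<Rightarrow> real^'d^'d \<Rightarrow> real^'d \<Rightarrow> real^'d^'d \<Rightarrow> real^'d^'k
    \<Rightarrow> (nat \<times> 'k::finite \<Rightarrow> nat) \<Rightarrow> ennreal" where
  "factorial_moment T m \<Phi> B b \<Psi> \<Gamma> j =
    (\<integral>\<^sup>+Y. obs_prob T m \<Phi> B b \<Psi> \<Gamma> (obs_seq Y) * ennreal (falling_factorial_weight T j Y) \<partial>obs_space T)"

lemma obs_prob_eq_count_likelihood:
  "obs_prob T m \<Phi> B b \<Psi> \<Gamma> (obs_seq Y) =
    (\<integral>\<^sup>+s. ennreal (latent_density T m \<Phi> B b \<Psi> s * count_likelihood T \<Gamma> s Y)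
      \<partial>PiM {..<T} (\<lambda>_. lborel))"
  by (simp add: obs_prob_def count_likelihood_def obs_index_def obs_seq_def
      prod.cartesian_product split_def)

lemma borel_measurable_count_likelihood:
  fixes \<Gamma> :: "real^'d^'k::finite"
  shows "(\<lambda>z. count_likelihood T \<Gamma> (fst z) (snd z))
    \<in> borel_measurable (PiM {..<T} (\<lambda>_. lborel :: (real^'d) measure) \<Otimes>\<^sub>M obs_space T)"
  unfolding count_likelihood_def
proof (intro borel_measurable_prod)
  let ?M = "PiM {..<T} (\<lambda>_. lborel :: (real^'d) measure) \<Otimes>\<^sub>M obs_space T"
  fix a :: "nat \<times> 'k"
  assume a: "a \<in> obs_index T"
  have [measurable]: "(\<lambda>s. s (fst a) $ i) \<in> borel_measurable (PiM {..<T} (\<lambda>_. lborel :: (real^'d) measure))" for i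
    using a by (intro measurable_PiM_vec_component) (auto simp: obs_index_def)
  have "(\<lambda>s. (\<Gamma> *v s (fst a)) $ snd a) \<in> borel_measurable (PiM {..<T} (\<lambda>_. lborel :: (real^'d) measure))"
    unfolding matrix_vector_mult_def vec_lambda_beta by measurable
  note [measurable] = measurable_compose[OF measurable_fst this]
  have count: "(\<lambda>z. snd z a) \<in> ?M \<rightarrow>\<^sub>M count_space UNIV"
    unfolding obs_space_def using a
    by (intro measurable_compose[OF measurable_snd measurable_component_singleton])
  show "(\<lambda>z. pmf (poisson_pmf (exp ((\<Gamma> *v fst z (fst a)) $ snd a))) (snd z a)) \<in> borel_measurable ?M"
  proof (rule measurable_compose_countable[OF _ count])
    fix n
    show "(\<lambda>z. pmf (poisson_pmf (exp ((\<Gamma> *v fst z (fst a)) $ snd a))) n) \<in> borel_measurable ?M"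
      by (simp add: pmf_poisson) measurable
  qed
qed

lemma borel_measurable_falling_factorial_weight:
  "falling_factorial_weight T j \<in> borel_measurable (obs_space T)"
  unfolding falling_factorial_weight_def obs_space_def
  by (intro borel_measurable_prod measurable_compose[OF measurable_component_singleton]) auto

lemma prod_rate_power_eq_exp_inner:
  fixes \<Gamma> :: "real^'d^'k::finite" and j :: "nat \<times> 'k \<Rightarrow> nat"
  assumes "2 \<le> T" and "\<And>t k. 2 \<le> t \<Longrightarrow> j (t, k) = 0"
  shows "(\<Prod>a\<in>obs_index T. exp ((\<Gamma> *v s (fst a)) $ snd a) ^ j a) =
    exp ((count_exponent j 0 v* \<Gamma>) \<bullet> s 0 + (count_exponent j 1 v* \<Gamma>) \<bullet> s 1)"
proof -
  have "(\<Prod>a\<in>obs_index T. exp ((\<Gamma> *v s (fst a)) $ snd a) ^ j a) =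
      exp (\<Sum>t<T. count_exponent j t \<bullet> (\<Gamma> *v s t))"
    by (simp add: obs_index_def exp_sum exp_of_nat_mult prod.cartesian_product inner_vec_def
        sum.cartesian_product split_def count_exponent_def)
  also have "(\<Sum>t<T. count_exponent j t \<bullet> (\<Gamma> *v s t)) = (\<Sum>t\<in>{0, 1}. count_exponent j t \<bullet> (\<Gamma> *v s t))"
    using assms by (intro sum.mono_neutral_right) (auto simp: inner_vec_def count_exponent_def)
  finally show ?thesis
    by (simp add: dot_lmul_matrix)
qed

lemma nn_integral_count_likelihood_falling_factorial:
  fixes \<Gamma> :: "real^'d^'k::finite" and j :: "nat \<times> 'k \<Rightarrow> nat"
  assumes "2 \<le> T" and "\<And>t k. 2 \<le> t \<Longrightarrow> j (t, k) = 0"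
  shows "(\<integral>\<^sup>+Y. ennreal (count_likelihood T \<Gamma> s Y * falling_factorial_weight T j Y) \<partial>obs_space T) =
    ennreal (exp ((count_exponent j 0 v* \<Gamma>) \<bullet> s 0 + (count_exponent j 1 v* \<Gamma>) \<bullet> s 1))"
proof -
  let ?rate = "\<lambda>a :: nat \<times> 'k. exp ((\<Gamma> *v s (fst a)) $ snd a)"
  have "(\<integral>\<^sup>+Y. ennreal (count_likelihood T \<Gamma> s Y * falling_factorial_weight T j Y) \<partial>obs_space T) =
      (\<integral>\<^sup>+Y. (\<Prod>a\<in>obs_index T. ennreal (pmf (poisson_pmf (?rate a)) (Y a) * (fact (j a) * real (Y a choose j a))))
        \<partial>obs_space T)"
    by (simp add: count_likelihood_def falling_factorial_weight_def prod_ennreal prod.distrib[symmetric])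
  also have "\<dots> = ennreal (\<Prod>a\<in>obs_index T. ?rate a ^ j a)"
    unfolding obs_space_def
    by (rule nn_integral_PiM_poisson_falling_factorial) (simp_all add: obs_index_def)
  finally show ?thesis
    by (simp add: prod_rate_power_eq_exp_inner[of T j, OF assms])
qed

lemma pair_sigma_finite_latent_obs_space:
  "pair_sigma_finite (PiM {..<T} (\<lambda>_. lborel :: (real^'d) measure)) (obs_space T :: (nat \<times> 'k::finite \<Rightarrow> nat) measure)"
proof -
  interpret counts: product_sigma_finite "\<lambda>_ :: nat \<times> 'k. count_space (UNIV :: nat set)"
    by (intro product_sigma_finite.intro sigma_finite_measure_count_space_countable) auto
  interpret counts: finite_product_sigma_finite "\<lambda>_ :: nat \<times> 'k. count_space (UNIV :: nat set)" "obs_index T"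
    by standard (simp add: obs_index_def)
  interpret latent: product_sigma_finite "\<lambda>_ :: nat. lborel :: (real^'d) measure"
    by standard
  interpret latent: finite_product_sigma_finite "\<lambda>_ :: nat. lborel :: (real^'d) measure" "{..<T}"
    by standard simp
  show ?thesis
    unfolding obs_space_def
    by (intro pair_sigma_finite.intro latent.sigma_finite_measure_axioms counts.sigma_finite_measure_axioms)
qed

lemma factorial_moment_eq_iterated_integral:
  fixes \<Gamma> :: "real^'d^'k::finite"
  assumes "0 < T"
  shows "factorial_moment T m \<Phi> B b \<Psi> \<Gamma> j = (\<integral>\<^sup>+Y. \<integral>\<^sup>+s. ennreal (latent_density T m \<Phi> B b \<Psi> s *
      (count_likelihood T \<Gamma> s Y * falling_factorial_weight T j Y)) \<partial>PiM {..<T} (\<lambda>_. lborel) \<partial>obs_space T)"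
proof -
  let ?M = "PiM {..<T} (\<lambda>_. lborel :: (real^'d) measure)"
  let ?L = "latent_density T m \<Phi> B b \<Psi>"
  have likelihood: "(\<lambda>z. ?L (fst z) * count_likelihood T \<Gamma> (fst z) (snd z)) \<in> borel_measurable (?M \<Otimes>\<^sub>M obs_space T)"
    using assms by (intro borel_measurable_times borel_measurable_count_likelihood
        measurable_compose[OF measurable_fst borel_measurable_latent_density]) auto
  show ?thesis
    unfolding factorial_moment_def obs_prob_eq_count_likelihood
  proof (rule nn_integral_cong)
    fix Y :: "nat \<times> 'k \<Rightarrow> nat"
    assume "Y \<in> space (obs_space T)"
    from measurable_compose[OF measurable_compose[OF measurable_Pair2'[OF this] likelihood] measurable_ennreal]
    have "(\<integral>\<^sup>+s. ennreal (?L s * count_likelihood T \<Gamma> s Y) \<partial>?M) * ennreal (falling_factorial_weight T j Y) =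
        (\<integral>\<^sup>+s. ennreal (?L s * count_likelihood T \<Gamma> s Y) * ennreal (falling_factorial_weight T j Y) \<partial>?M)"
      by (simp add: nn_integral_multc)
    moreover have "0 \<le> falling_factorial_weight T j Y"
      by (simp add: falling_factorial_weight_def prod_nonneg)
    ultimately show "(\<integral>\<^sup>+s. ennreal (?L s * count_likelihood T \<Gamma> s Y) \<partial>?M) * ennreal (falling_factorial_weight T j Y) =
        (\<integral>\<^sup>+s. ennreal (?L s * (count_likelihood T \<Gamma> s Y * falling_factorial_weight T j Y)) \<partial>?M)"
      by (simp add: ennreal_mult''[symmetric] mult.assoc)
  qed
qed

lemma factorial_moment_eq_latent_mgf:
  fixes \<Gamma> :: "real^'d^'k::finite" and j :: "nat \<times> 'k \<Rightarrow> nat"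
  assumes T: "2 \<le> T" and j: "\<And>t k. 2 \<le> t \<Longrightarrow> j (t, k) = 0"
    and \<Phi>: "\<And>i. 0 < \<Phi> $ i $ i" and \<Psi>: "\<And>i. 0 < \<Psi> $ i $ i"
  shows "factorial_moment T m \<Phi> B b \<Psi> \<Gamma> j = ennreal (exp (latent_log_mgf m \<Phi> B b \<Psi>
    (count_exponent j 0 v* \<Gamma>) (count_exponent j 1 v* \<Gamma>)))"
proof -
  let ?M = "PiM {..<T} (\<lambda>_. lborel :: (real^'d) measure)"
  let ?L = "latent_density T m \<Phi> B b \<Psi>"
  let ?CW = "\<lambda>s Y. count_likelihood T \<Gamma> s Y * falling_factorial_weight T j Y"
  let ?E = "\<lambda>s. exp ((count_exponent j 0 v* \<Gamma>) \<bullet> s 0 + (count_exponent j 1 v* \<Gamma>) \<bullet> s 1)"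
  interpret pair_sigma_finite ?M "obs_space T :: (nat \<times> 'k \<Rightarrow> nat) measure"
    by (rule pair_sigma_finite_latent_obs_space)
  have counts: "(\<lambda>z. ?CW (fst z) (snd z)) \<in> borel_measurable (?M \<Otimes>\<^sub>M obs_space T)"
    by (intro borel_measurable_times borel_measurable_count_likelihood
        measurable_compose[OF measurable_snd borel_measurable_falling_factorial_weight])
  have joint: "(\<lambda>z. ennreal (?L (fst z) * ?CW (fst z) (snd z))) \<in> borel_measurable (?M \<Otimes>\<^sub>M obs_space T)"
    using T by (intro measurable_compose[OF _ measurable_ennreal] borel_measurable_times counts
        measurable_compose[OF measurable_fst borel_measurable_latent_density]) auto
  have "factorial_moment T m \<Phi> B b \<Psi> \<Gamma> j = (\<integral>\<^sup>+Y. \<integral>\<^sup>+s. ennreal (?L s * ?CW s Y) \<partial>?M \<partial>obs_space T)"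
    using T by (simp add: factorial_moment_eq_iterated_integral)
  also have "\<dots> = (\<integral>\<^sup>+s. \<integral>\<^sup>+Y. ennreal (?L s * ?CW s Y) \<partial>obs_space T \<partial>?M)"
    using Fubini'[of "\<lambda>s Y. ennreal (?L s * ?CW s Y)"] joint by (simp add: case_prod_beta')
  also have "\<dots> = (\<integral>\<^sup>+s. ennreal (?L s) * ennreal (?E s) \<partial>?M)"
  proof (rule nn_integral_cong)
    fix s :: "nat \<Rightarrow> real^'d"
    assume "s \<in> space ?M"
    from measurable_compose[OF measurable_compose[OF measurable_Pair1'[OF this] counts] measurable_ennreal]
    have "(\<integral>\<^sup>+Y. ennreal (?L s * ?CW s Y) \<partial>obs_space T) = ennreal (?L s) * (\<integral>\<^sup>+Y. ennreal (?CW s Y) \<partial>obs_space T)"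
      by (simp add: latent_density_nonneg ennreal_mult' nn_integral_cmult)
    then show "(\<integral>\<^sup>+Y. ennreal (?L s * ?CW s Y) \<partial>obs_space T) = ennreal (?L s) * ennreal (?E s)"
      by (simp add: nn_integral_count_likelihood_falling_factorial[where j=j, OF T j])
  qed
  also have "\<dots> = ennreal (exp (latent_log_mgf m \<Phi> B b \<Psi>
      (count_exponent j 0 v* \<Gamma>) (count_exponent j 1 v* \<Gamma>)))"
    using nn_integral_latent_density_exp[OF T \<Phi> \<Psi>] by (simp add: latent_density_nonneg ennreal_mult')
  finally show ?thesis .
qed

section \<open>Diagonal matrices and congruence\<close>

definition diag_matrix :: "('n::finite \<Rightarrow> 'a::semiring_1) \<Rightarrow> 'a^'n^'n" where
  "diag_matrix v = (\<chi> i j. if i = j then v i else 0)"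

lemma matrix_mul_diag_matrix_right [simp]: "(A ** diag_matrix v) $ i $ j = A $ i $ j * v j"
  by (simp add: diag_matrix_def matrix_matrix_mult_def if_distrib if_distribR cong: if_cong)

lemma matrix_mul_diag_matrix_left [simp]: "(diag_matrix v ** A) $ i $ j = v i * A $ i $ j"
  by (simp add: diag_matrix_def matrix_matrix_mult_def if_distrib if_distribR cong: if_cong)

lemma diag_matrix_mult: "diag_matrix u ** diag_matrix v = diag_matrix (\<lambda>i. u i * v i)"
  by (simp add: vec_eq_iff) (simp add: diag_matrix_def)

lemma diag_matrix_const [simp]: "diag_matrix (\<lambda>_. c) = mat c"
  by (simp add: vec_eq_iff diag_matrix_def mat_def)

lemma is_diag_diag_matrix: "is_diag (diag_matrix v)"
  by (simp add: is_diag_def diag_matrix_def)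

lemma matrix_inv_unique:
  fixes A :: "'a::semiring_1^'n^'n"
  assumes "A ** B = mat 1" and "B ** A = mat 1"
  shows "matrix_inv A = B"
proof -
  have "A ** matrix_inv A = mat 1 \<and> matrix_inv A ** A = mat 1"
    unfolding matrix_inv_def by (rule someI[of _ B]) (use assms in auto)
  then have "matrix_inv A = matrix_inv A ** (A ** B)"
    by (simp add: assms)
  also have "\<dots> = B"
    by (simp add: matrix_mul_assoc \<open>_ \<and> _\<close>)
  finally show ?thesis .
qed

lemma
  fixes v :: "'n::finite \<Rightarrow> 'a::field"
  assumes "\<And>i. v i \<noteq> 0"
  shows invertible_diag_matrix: "invertible (diag_matrix v)"
    and matrix_inv_diag_matrix: "matrix_inv (diag_matrix v) = diag_matrix (\<lambda>i. inverse (v i))"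
proof -
  have "diag_matrix v ** diag_matrix (\<lambda>i. inverse (v i)) = mat 1"
    "diag_matrix (\<lambda>i. inverse (v i)) ** diag_matrix v = mat 1"
    using assms by (simp_all add: diag_matrix_mult)
  then show "invertible (diag_matrix v)"
    and "matrix_inv (diag_matrix v) = diag_matrix (\<lambda>i. inverse (v i))"
    by (auto simp: invertible_def intro: matrix_inv_unique)
qed

lemma perm_matrix_mul_entry:
  "(A ** (\<chi> i j. if i = p j then 1 else 0)) $ k $ j = A $ k $ p j"
  by (simp add: matrix_matrix_mult_def if_distrib cong: if_cong)

lemma vector_matrix_left_distrib: "(x + y) v* A = x v* A + y v* (A :: 'a::semiring_1^'n^'m)"
  by (simp add: vector_matrix_mult_def vec_eq_iff sum.distrib algebra_simps)

lemma axis_vector_matrix_mult [simp]: "(axis k (1::'a::semiring_1) v* A) $ i = A $ k $ i"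
  by (simp add: vector_matrix_mult_def axis_def if_distrib if_distribR cong: if_cong)

lemma matrix_mul_transpose_diag_matrix_entry:
  fixes G :: "'a::comm_semiring_1^'n::finite^'m"
  shows "(G ** diag_matrix v ** transpose G) $ k $ l = (\<Sum>i\<in>UNIV. G $ k $ i * v i * G $ l $ i)"
proof -
  have "(A ** transpose G) $ k $ l = (\<Sum>i\<in>UNIV. A $ k $ i * G $ l $ i)" for A :: "'a^'n^'m"
    by (simp add: matrix_matrix_mult_def transpose_def)
  then show ?thesis
    by simp
qed

lemma matrix_mul_left_cancel:
  fixes G :: "'a::field^'n^'m"
  assumes "inj ((*v) G)" and "G ** X = G ** Y"
  shows "X = Y"
proof -
  obtain L where "L ** G = mat 1"
    using assms(1) matrix_left_invertible_injective by blast
  then show ?thesis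
    by (metis assms(2) matrix_mul_assoc matrix_mul_lid)
qed

lemma matrix_mul_transpose_right_cancel:
  fixes G :: "'a::field^'n^'m"
  assumes "inj ((*v) G)" and "X ** transpose G = Y ** transpose G"
  shows "X = Y"
proof -
  have "G ** transpose X = G ** transpose Y"
    using arg_cong[OF assms(2), of transpose] by (simp add: matrix_transpose_mul)
  then show ?thesis
    by (metis matrix_mul_left_cancel[OF assms(1)] transpose_transpose)
qed

lemma matrix_congruence_cancel:
  fixes G :: "'a::field^'n^'m"
  assumes "inj ((*v) G)" and "G ** X ** transpose G = G ** Y ** transpose G"
  shows "X = Y"
  using assms by (metis matrix_mul_left_cancel matrix_mul_transpose_right_cancel)

lemma column_space_of_congruent_diagonal:
  fixes G G' :: "real^'d::finite^'k::finite"
  assumes "inj ((*v) G')" and "\<And>i. \<phi>' i \<noteq> 0"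
    and "G ** diag_matrix \<phi> ** transpose G = G' ** diag_matrix \<phi>' ** transpose G'"
  shows "\<exists>R. G' = G ** R"
proof -
  obtain L' where L': "L' ** G' = mat 1"
    using assms(1) matrix_left_invertible_injective by blast
  define \<phi>'_inv where "\<phi>'_inv = diag_matrix (\<lambda>i. inverse (\<phi>' i))"
  have \<phi>'_inv: "diag_matrix \<phi>' ** \<phi>'_inv = mat 1"
    using assms(2) by (simp add: \<phi>'_inv_def diag_matrix_mult)
  have "G' = G' ** diag_matrix \<phi>' ** transpose (L' ** G') ** \<phi>'_inv"
    by (simp add: L' \<phi>'_inv matrix_mul_assoc[symmetric])
  also have "\<dots> = (G' ** diag_matrix \<phi>' ** transpose G') ** (transpose L' ** \<phi>'_inv)"
    by (simp add: matrix_transpose_mul matrix_mul_assoc)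
  also have "\<dots> = G ** (diag_matrix \<phi> ** transpose G ** transpose L' ** \<phi>'_inv)"
    by (simp add: assms(3)[symmetric] matrix_mul_assoc)
  finally show ?thesis ..
qed

lemma intertwiner_of_distinct_diagonals:
  fixes R :: "real^'d::finite^'d"
  assumes "inj \<beta>" and "inj \<beta>'" and "inj ((*v) R)"
    and intertwines: "\<And>i j. \<beta> i * R $ i $ j = R $ i $ j * \<beta>' j"
  obtains p where "p permutes (UNIV :: 'd set)"
    and "\<And>j. R $ p j $ j \<noteq> 0" and "\<And>i j. i \<noteq> p j \<Longrightarrow> R $ i $ j = 0"
proof -
  have "\<exists>i. R $ i $ j \<noteq> 0" for j
  proof (rule ccontr)
    assume "\<not> (\<exists>i. R $ i $ j \<noteq> 0)"
    then have "R *v axis j 1 = R *v 0"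
      by (simp add: vec_eq_iff matrix_vector_mult_def axis_def if_distrib if_distribR cong: if_cong)
    then have "axis j (1::real) = 0"
      by (rule injD[OF assms(3)])
    then show False
      by simp
  qed
  then obtain p where nonzero: "R $ p j $ j \<noteq> 0" for j
    by metis
  have \<beta>_p: "\<beta> (p j) = \<beta>' j" for j
    using intertwines[of "p j" j] nonzero[of j] by simp
  have zero: "R $ i $ j = 0" if "i \<noteq> p j" for i j
  proof (rule ccontr)
    assume "R $ i $ j \<noteq> 0"
    then have "\<beta> i = \<beta> (p j)"
      using intertwines[of i j] \<beta>_p[of j] by simp
    with \<open>i \<noteq> p j\<close> show False
      using assms(1) by (simp add: inj_eq)
  qed
  have "inj p"
    using \<beta>_p assms(2) by (metis injI inj_eq)
  then have "p permutes UNIV"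
    by (rule inj_imp_permutes) auto
  with nonzero zero show ?thesis
    using that by blast
qed

lemma congruent_diagonal_pencils_perm_scaling:
  fixes G G' :: "real^'d::finite^'k::finite"
  assumes "inj ((*v) G)" and "inj ((*v) G')"
    and "\<And>i. \<phi> i \<noteq> 0" and "\<And>i. \<phi>' i \<noteq> 0" and "inj \<beta>" and "inj \<beta>'"
    and cong1: "G ** diag_matrix \<phi> ** transpose G = G' ** diag_matrix \<phi>' ** transpose G'"
    and cong2: "G ** diag_matrix (\<lambda>i. \<beta> i * \<phi> i) ** transpose G =
      G' ** diag_matrix (\<lambda>i. \<beta>' i * \<phi>' i) ** transpose G'"
  obtains p c where "p permutes (UNIV :: 'd set)" and "\<And>j. c j \<noteq> 0"
    and "\<And>k j. G' $ k $ j = G $ k $ p j * c j"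
proof -
  obtain R where G': "G' = G ** R"
    using column_space_of_congruent_diagonal[OF assms(2,4) cong1] by blast
  have "inj ((*v) R)"
    using assms(2) unfolding G' by (metis injI injD matrix_vector_mul_assoc)
  have diag_congruent: "diag_matrix w = R ** diag_matrix w' ** transpose R"
    if "G ** diag_matrix w ** transpose G = G' ** diag_matrix w' ** transpose G'" for w w'
    using that unfolding G'
    by (intro matrix_congruence_cancel[OF assms(1)]) (simp add: matrix_transpose_mul matrix_mul_assoc)
  have "(diag_matrix \<beta> ** R ** diag_matrix \<phi>') ** transpose R =
      (R ** diag_matrix \<beta>' ** diag_matrix \<phi>') ** transpose R"
    using diag_congruent[OF cong1] diag_congruent[OF cong2]
    by (metis (no_types) diag_matrix_mult matrix_mul_assoc)
  then have "diag_matrix \<beta> ** R ** diag_matrix \<phi>' = R ** diag_matrix \<beta>' ** diag_matrix \<phi>'"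
    using matrix_mul_transpose_right_cancel[OF \<open>inj ((*v) R)\<close>] by blast
  then have "\<beta> i * R $ i $ j = R $ i $ j * \<beta>' j" for i j
    using arg_cong[of _ _ "\<lambda>M. M $ i $ j"] assms(4)[of j] by (auto simp: vec_eq_iff)
  then obtain p where p: "p permutes UNIV" "\<And>j. R $ p j $ j \<noteq> 0"
    and zero: "\<And>i j. i \<noteq> p j \<Longrightarrow> R $ i $ j = 0"
    using intertwiner_of_distinct_diagonals[OF assms(5,6) \<open>inj ((*v) R)\<close>] by blast
  have entries: "G' $ k $ j = G $ k $ p j * R $ p j $ j" for k j
  proof -
    have "G' $ k $ j = (\<Sum>i\<in>UNIV. G $ k $ i * R $ i $ j)"
      by (simp add: G' matrix_matrix_mult_def)
    also have "\<dots> = G $ k $ p j * R $ p j $ j"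
      by (subst sum.remove[of _ "p j"]) (auto simp: zero intro!: sum.neutral)
    finally show ?thesis .
  qed
  show ?thesis
    using p entries by (rule that[of p "\<lambda>j. R $ p j $ j"])
qed

lemma perm_scaling_eq_matrix_mult:
  fixes G G' :: "real^'d::finite^'k::finite"
  assumes "p permutes UNIV" and "\<And>j. c j \<noteq> 0" and "\<And>k j. G' $ k $ j = G $ k $ p j * c j"
  shows "\<exists>P D. is_perm_matrix P \<and> is_diag D \<and> invertible D \<and> G' = G ** P ** matrix_inv D"
proof -
  define P :: "real^'d^'d" where "P = (\<chi> i j. if i = p j then 1 else 0)"
  define D where "D = diag_matrix (\<lambda>j. inverse (c j))"
  have "is_perm_matrix P"
    unfolding is_perm_matrix_def P_def using assms(1) by blast
  moreover have "is_diag D" and "invertible D"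
    using assms(2) by (simp_all add: D_def is_diag_diag_matrix invertible_diag_matrix)
  moreover have "G' = G ** P ** matrix_inv D"
    using assms(2,3) by (simp add: D_def P_def matrix_inv_diag_matrix vec_eq_iff perm_matrix_mul_entry)
  ultimately show ?thesis
    by blast
qed

section \<open>Identification of the mixing matrix\<close>

lemma latent_log_mgf_polarization:
  "latent_log_mgf m \<Phi> B b \<Psi> (x0 + y0) (x1 + y1) - latent_log_mgf m \<Phi> B b \<Psi> x0 x1 -
      latent_log_mgf m \<Phi> B b \<Psi> y0 y1 =
    (\<Sum>i\<in>UNIV. (x0 $ i + x1 $ i * B $ i $ i) * (y0 $ i + y1 $ i * B $ i $ i) * \<Phi> $ i $ i +
      x1 $ i * y1 $ i * \<Psi> $ i $ i)"
  unfolding latent_log_mgf_def sum_subtractf[symmetric]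
  by (rule sum.cong) (simp_all add: power2_eq_square field_simps)

lemma count_exponent_add: "count_exponent (\<lambda>a. i a + j a) t = count_exponent i t + count_exponent j t"
  by (simp add: count_exponent_def vec_eq_iff)

lemma count_exponent_indicator:
  "count_exponent (\<lambda>a. if a = (s, k) then 1 else 0) t = (if t = s then axis k 1 else 0)"
  by (simp add: count_exponent_def vec_eq_iff axis_def)

lemma latent_log_mgf_eq_if_obs_prob_eq:
  fixes \<Gamma> \<Gamma>' :: "real^'d^'k::finite" and j :: "nat \<times> 'k \<Rightarrow> nat"
  assumes T: "2 \<le> T" and j: "\<And>t k. 2 \<le> t \<Longrightarrow> j (t, k) = 0"
    and \<Phi>: "\<And>i. 0 < \<Phi> $ i $ i" and \<Psi>: "\<And>i. 0 < \<Psi> $ i $ i"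
    and \<Phi>': "\<And>i. 0 < \<Phi>' $ i $ i" and \<Psi>': "\<And>i. 0 < \<Psi>' $ i $ i"
    and law: "\<And>y. obs_prob T m \<Phi> B b \<Psi> \<Gamma> y = obs_prob T m' \<Phi>' B' b' \<Psi>' \<Gamma>' y"
  shows "latent_log_mgf m \<Phi> B b \<Psi> (count_exponent j 0 v* \<Gamma>) (count_exponent j 1 v* \<Gamma>) =
    latent_log_mgf m' \<Phi>' B' b' \<Psi>' (count_exponent j 0 v* \<Gamma>') (count_exponent j 1 v* \<Gamma>')"
proof -
  have "factorial_moment T m \<Phi> B b \<Psi> \<Gamma> j = factorial_moment T m' \<Phi>' B' b' \<Psi>' \<Gamma>' j"
    by (simp add: factorial_moment_def law)
  then show ?thesis
    using factorial_moment_eq_latent_mgf[where j=j and m=m and B=B and b=b and \<Gamma>=\<Gamma>, OF T j \<Phi> \<Psi>]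
      factorial_moment_eq_latent_mgf[where j=j and m=m' and B=B' and b=b' and \<Gamma>=\<Gamma>', OF T j \<Phi>' \<Psi>']
    by simp
qed

lemma covariances_eq_if_obs_prob_eq:
  fixes \<Gamma> \<Gamma>' :: "real^'d^'k::finite"
  assumes T: "2 \<le> T"
    and \<Phi>: "\<And>i. 0 < \<Phi> $ i $ i" and \<Psi>: "\<And>i. 0 < \<Psi> $ i $ i"
    and \<Phi>': "\<And>i. 0 < \<Phi>' $ i $ i" and \<Psi>': "\<And>i. 0 < \<Psi>' $ i $ i"
    and law: "\<And>y. obs_prob T m \<Phi> B b \<Psi> \<Gamma> y = obs_prob T m' \<Phi>' B' b' \<Psi>' \<Gamma>' y"
  shows "\<Gamma> ** diag_matrix (\<lambda>i. \<Phi> $ i $ i) ** transpose \<Gamma> =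
      \<Gamma>' ** diag_matrix (\<lambda>i. \<Phi>' $ i $ i) ** transpose \<Gamma>'"
    and "\<Gamma> ** diag_matrix (\<lambda>i. B $ i $ i * \<Phi> $ i $ i) ** transpose \<Gamma> =
      \<Gamma>' ** diag_matrix (\<lambda>i. B' $ i $ i * \<Phi>' $ i $ i) ** transpose \<Gamma>'"
proof -
  define Q where "Q m \<Phi> B b \<Psi> \<Gamma> j =
    latent_log_mgf m \<Phi> B b \<Psi> (count_exponent j 0 v* \<Gamma>) (count_exponent j 1 v* \<Gamma>)"
    for m \<Phi> B b \<Psi> and \<Gamma> :: "real^'d^'k" and j
  define \<delta> :: "nat \<times> 'k \<Rightarrow> nat \<times> 'k \<Rightarrow> nat" where "\<delta> a = (\<lambda>z. if z = a then 1 else 0)" for a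
  have Q_eq: "Q m \<Phi> B b \<Psi> \<Gamma> j = Q m' \<Phi>' B' b' \<Psi>' \<Gamma>' j"
    if "\<And>t k. 2 \<le> t \<Longrightarrow> j (t, k) = 0" for j
    unfolding Q_def using latent_log_mgf_eq_if_obs_prob_eq[where j=j, OF T that \<Phi> \<Psi> \<Phi>' \<Psi>' law] .
  have polarized: "Q m \<Phi> B b \<Psi> \<Gamma> (\<lambda>z. \<delta> a z + \<delta> a' z) - Q m \<Phi> B b \<Psi> \<Gamma> (\<delta> a) - Q m \<Phi> B b \<Psi> \<Gamma> (\<delta> a') =
      Q m' \<Phi>' B' b' \<Psi>' \<Gamma>' (\<lambda>z. \<delta> a z + \<delta> a' z) - Q m' \<Phi>' B' b' \<Psi>' \<Gamma>' (\<delta> a) - Q m' \<Phi>' B' b' \<Psi>' \<Gamma>' (\<delta> a')"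
    if "fst a \<le> 1" and "fst a' \<le> 1" for a a'
  proof -
    have "Q m \<Phi> B b \<Psi> \<Gamma> j = Q m' \<Phi>' B' b' \<Psi>' \<Gamma>' j" if "j \<in> {\<lambda>z. \<delta> a z + \<delta> a' z, \<delta> a, \<delta> a'}" for j
      using that \<open>fst a \<le> 1\<close> \<open>fst a' \<le> 1\<close> by (auto intro!: Q_eq simp: \<delta>_def)
    then show ?thesis
      by simp
  qed
  have rows:
    "Q m \<Phi> B b \<Psi> \<Gamma> (\<lambda>z. \<delta> (0, k) z + \<delta> (0, l) z) - Q m \<Phi> B b \<Psi> \<Gamma> (\<delta> (0, k)) - Q m \<Phi> B b \<Psi> \<Gamma> (\<delta> (0, l)) =
      (\<Sum>i\<in>UNIV. \<Gamma> $ k $ i * \<Gamma> $ l $ i * \<Phi> $ i $ i)"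
    "Q m \<Phi> B b \<Psi> \<Gamma> (\<lambda>z. \<delta> (0, k) z + \<delta> (1, l) z) - Q m \<Phi> B b \<Psi> \<Gamma> (\<delta> (0, k)) - Q m \<Phi> B b \<Psi> \<Gamma> (\<delta> (1, l)) =
      (\<Sum>i\<in>UNIV. \<Gamma> $ k $ i * (\<Gamma> $ l $ i * B $ i $ i) * \<Phi> $ i $ i)"
    for m \<Phi> B b \<Psi> and \<Gamma> :: "real^'d^'k" and k l
    using latent_log_mgf_polarization[of m \<Phi> B b \<Psi> "axis k 1 v* \<Gamma>" "axis l 1 v* \<Gamma>" 0 0]
      latent_log_mgf_polarization[of m \<Phi> B b \<Psi> "axis k 1 v* \<Gamma>" 0 0 "axis l 1 v* \<Gamma>"]
    by (simp_all add: Q_def \<delta>_def count_exponent_add count_exponent_indicator vector_matrix_left_distrib)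
  have "(\<Sum>i\<in>UNIV. \<Gamma> $ k $ i * \<Gamma> $ l $ i * \<Phi> $ i $ i) = (\<Sum>i\<in>UNIV. \<Gamma>' $ k $ i * \<Gamma>' $ l $ i * \<Phi>' $ i $ i)"
    "(\<Sum>i\<in>UNIV. \<Gamma> $ k $ i * (\<Gamma> $ l $ i * B $ i $ i) * \<Phi> $ i $ i) =
      (\<Sum>i\<in>UNIV. \<Gamma>' $ k $ i * (\<Gamma>' $ l $ i * B' $ i $ i) * \<Phi>' $ i $ i)" for k l
    using polarized[of "(0, k)" "(0, l)"] polarized[of "(0, k)" "(1, l)"]
      rows[of m \<Phi> B b \<Psi> \<Gamma> k l] rows[of m' \<Phi>' B' b' \<Psi>' \<Gamma>' k l]
    by simp_all
  then show
    "\<Gamma> ** diag_matrix (\<lambda>i. \<Phi> $ i $ i) ** transpose \<Gamma> =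
      \<Gamma>' ** diag_matrix (\<lambda>i. \<Phi>' $ i $ i) ** transpose \<Gamma>'"
    "\<Gamma> ** diag_matrix (\<lambda>i. B $ i $ i * \<Phi> $ i $ i) ** transpose \<Gamma> =
      \<Gamma>' ** diag_matrix (\<lambda>i. B' $ i $ i * \<Phi>' $ i $ i) ** transpose \<Gamma>'"
    by (simp_all add: vec_eq_iff matrix_mul_transpose_diag_matrix_entry mult_ac)
qed

theorem mainTheorem5:
  fixes T :: nat
    and m m' b b' :: "real^'d"
    and \<Phi> \<Phi>' B B' \<Psi> \<Psi>' :: "real^'d^'d"
    and \<Gamma> \<Gamma>' :: "real^'d^'k"
  assumes "CARD('d) \<le> CARD('k)"
    and "T \<ge> 2"
    and "ARPLN_params m \<Phi> B b \<Psi>"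
    and "ARPLN_params m' \<Phi>' B' b' \<Psi>'"
    and "rank \<Gamma> = CARD('d)" and "rank \<Gamma>' = CARD('d)"
    and "\<forall>i. B $ i $ i \<noteq> 0" and "\<forall>i j. i \<noteq> j \<longrightarrow> B $ i $ i \<noteq> B $ j $ j"
    and "\<forall>i. B' $ i $ i \<noteq> 0" and "\<forall>i j. i \<noteq> j \<longrightarrow> B' $ i $ i \<noteq> B' $ j $ j"
    and "\<forall>y. obs_prob T m \<Phi> B b \<Psi> \<Gamma> y = obs_prob T m' \<Phi>' B' b' \<Psi>' \<Gamma>' y"
  shows "\<exists>P D. is_perm_matrix P \<and> is_diag D \<and> invertible D \<and>
           \<Gamma>' = \<Gamma> ** P ** matrix_inv D"
proof -
  \<comment> \<open>Not needed: \<open>CARD('d) \<le> CARD('k)\<close> (implied by full rank) and the nonvanishing of the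
    diagonals of \<open>B\<close>, \<open>B'\<close> (distinctness suffices).\<close>
  have \<Phi>: "\<And>i. 0 < \<Phi> $ i $ i" and \<Psi>: "\<And>i. 0 < \<Psi> $ i $ i"
    and \<Phi>': "\<And>i. 0 < \<Phi>' $ i $ i" and \<Psi>': "\<And>i. 0 < \<Psi>' $ i $ i"
    using assms(3,4) by (auto simp: ARPLN_params_def)
  have nonzero: "\<And>i. \<Phi> $ i $ i \<noteq> 0" "\<And>i. \<Phi>' $ i $ i \<noteq> 0"
    using \<Phi> \<Phi>' by (metis less_irrefl)+
  have injective: "inj ((*v) \<Gamma>)" "inj ((*v) \<Gamma>')"
    using assms(5,6) full_rank_injective by blast+
  have distinct: "inj (\<lambda>i. B $ i $ i)" "inj (\<lambda>i. B' $ i $ i)"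
    using assms(8,10) unfolding inj_def by blast+
  obtain p c where "p permutes UNIV" and "\<And>j. c j \<noteq> 0"
    and "\<And>k j. \<Gamma>' $ k $ j = \<Gamma> $ k $ p j * c j"
    using congruent_diagonal_pencils_perm_scaling[OF injective nonzero distinct
        covariances_eq_if_obs_prob_eq[OF assms(2) \<Phi> \<Psi> \<Phi>' \<Psi>' spec[OF assms(11)]]]
    by blast
  then show ?thesis
    by (rule perm_scaling_eq_matrix_mult)
qed

end
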